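(* Let $N\ge 2$, let $C\in M_N(\mathbb{R})$, and let $f:[0,1]\to\mathbb{R}$ be strictly convex and continuous with $f\in C^1((0,1])$. Let $((x^n,y^n))_{n\in\mathbb{N}}$ be a sequence in $(\mathcal{P}_N\times\mathcal{P}_N,\|\cdot\|_2)$ converging to $(x,y)$, and let $(\gamma_n)_{n\in\mathbb{N}}$ be a sequence in $(0,\infty)$ converging to $\gamma\in[0,\infty]$. For each $n$ let $P^{\gamma_n}$ be the $(f,\gamma_n)$-coupling between $x^n,y^n$. Then $$\lim_{n\to\infty}P^{\gamma_n}=\begin{cases}x\otimes y & \text{if }\gamma=\infty,\\ P^\gamma & \text{if }\gamma\in(0,\infty),\\ \Pi_\ast & \text{if }\gamma=0,\end{cases}$$ where $P^\gamma$ is the $(f,\gamma)$-coupling between $x,y$, and $\Pi_\ast$ is the optimal coupling between $x,y$ such that $\mathcal{D}_f(\Pi_\ast,x\otimes y)=\Lambda(x,y)$. Hence the function on $(0,\infty)\times\mathcal{P}_N\times\mathcal{P}_N$ sending $(\gamma,x,y)$ to $\mathcal{C}^\gamma(x,y)$ is continuous and can be extended continuously to $[0,\infty]\times\mathcal{P}_N\times\mathcal{P}_N$.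
   Context: $\mathcal{P}_N=\{x\in\mathbb{R}^N: x_i\ge 0,\ \sum_i x_i=1\}$. For $x,y\in\mathcal{P}_N$, $\Pi(x,y)$ is the set of couplings: matrices $\Pi=(\pi_{ij})\in M_N(\mathbb{R})$ with $\pi_{ij}\ge 0$, $\sum_k\pi_{ik}=x_i$, $\sum_k\pi_{kj}=y_j$ for all $i,j$. $(x\otimes y)_{ij}=x_iy_j$. $\langle C,\Pi\rangle=\sum_{i,j}c_{ij}\pi_{ij}$; $\|\cdot\|_2$ is the Euclidean (Frobenius) norm. $\mathcal{C}(x,y)=\inf_{\Pi\in\Pi(x,y)}\langle C,\Pi\rangle$, and a coupling attaining this infimum is called optimal. Bregman divergence: $f'(0):=\lim_{\varepsilon\downarrow 0}f'(\varepsilon)\in[-\infty,\infty)$, with the convention $\pm\infty\cdot 0=0$; $D_f(r,r_0)=f(r)-f(r_0)-f'(r_0)(r-r_0)$ for $r,r_0\in[0,1]$, and $\mathcal{D}_f(\Pi,\widetilde\Pi)=\sum_{i,j=1}^N D_f(\pi_{ij},\widetilde\pi_{ij})$. (For $\Pi\in\Pi(x,y)$, the entries with $x_iy_j=0$ contribute $0$ to $\mathcal{D}_f(\Pi,x\otimes y)$, which is finite and nonnegative.) For $\gamma>0$, $\mathcal{F}^\gamma_{x,y}(\Pi)=\langle C,\Pi\rangle+\gamma\mathcal{D}_f(\Pi,x\otimes y)$ on $\Pi(x,y)$; an $(f,\gamma)$-coupling between $x,y$ is a minimizer of $\mathcal{F}^\gamma_{x,y}$ over $\Pi(x,y)$ (it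 exists and is unique for $\gamma>0$). $\mathcal{C}^\gamma(x,y)=\langle C,P^\gamma\rangle$ with $P^\gamma$ the $(f,\gamma)$-coupling between $x,y$. $\Lambda(x,y)=\inf\{\mathcal{D}_f(\Pi,x\otimes y)\mid \Pi\in\Pi(x,y)\text{ is an optimal coupling}\}$; this infimum is attained at a unique optimal coupling. *)

theory Defs
  imports "HOL-Analysis.Analysis"
begin

definition strictly_convex_on :: "real set \<Rightarrow> (real \<Rightarrow> real) \<Rightarrow> bool" where
  "strictly_convex_on S f \<longleftrightarrow> convex S \<and>
    (\<forall>r\<in>S. \<forall>s\<in>S. \<forall>t. r \<noteq> s \<and> 0 < t \<and> t < 1 \<longrightarrow>
      f ((1 - t) * r + t * s) < (1 - t) * f r + t * f s)"

text \<open>Derivatives are taken relative to \<open>S\<close>, hence one-sided at the right end point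
  of \<open>(0,1]\<close>; values of \<open>f\<close> outside \<open>[0,1]\<close> are never used.\<close>

definition C1_on :: "real set \<Rightarrow> (real \<Rightarrow> real) \<Rightarrow> bool" where
  "C1_on S f \<longleftrightarrow> (\<exists>f'. continuous_on S f' \<and>
    (\<forall>r\<in>S. (f has_real_derivative f' r) (at r within S)))"

definition slope :: "(real \<Rightarrow> real) \<Rightarrow> real \<Rightarrow> real" where
  "slope f r = vector_derivative f (at r within {0<..1})"

definition slope_ext :: "(real \<Rightarrow> real) \<Rightarrow> real \<Rightarrow> ereal" where
  "slope_ext f r = (if r = 0 then Lim (at_right 0) (\<lambda>e. ereal (slope f e)) else ereal (slope f r))"

text \<open>The slope at \<open>0\<close> may be \<open>-\<infinity>\<close>. Multiplication on \<^typ>\<open>ereal\<close> satisfies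
  \<open>\<plusminus>\<infinity> * 0 = 0\<close>, which is the convention needed for \<open>r = r0 = 0\<close>;
  for \<open>r > 0 = r0\<close> the value is then \<open>\<infinity>\<close>.\<close>

definition bregman :: "(real \<Rightarrow> real) \<Rightarrow> real \<Rightarrow> real \<Rightarrow> ereal" where
  "bregman f r r0 = ereal (f r) - ereal (f r0) - slope_ext f r0 * ereal (r - r0)"

definition bregman_mat :: "(real \<Rightarrow> real) \<Rightarrow> real^'n^'n \<Rightarrow> real^'n^'n \<Rightarrow> ereal" where
  "bregman_mat f P Q = (\<Sum>i\<in>UNIV. \<Sum>j\<in>UNIV. bregman f (P $ i $ j) (Q $ i $ j))"

definition prob_vectors :: "(real^'n) set" where
  "prob_vectors = {x. (\<forall>i. 0 \<le> x $ i) \<and> (\<Sum>i\<in>UNIV. x $ i) = 1}"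

definition couplings :: "real^'n \<Rightarrow> real^'n \<Rightarrow> (real^'n^'n) set" where
  "couplings x y = {P. (\<forall>i j. 0 \<le> P $ i $ j) \<and>
     (\<forall>i. (\<Sum>k\<in>UNIV. P $ i $ k) = x $ i) \<and>
     (\<forall>j. (\<Sum>k\<in>UNIV. P $ k $ j) = y $ j)}"

definition outer :: "real^'n \<Rightarrow> real^'n \<Rightarrow> real^'n^'n" where
  "outer x y = (\<chi> i j. x $ i * y $ j)"

text \<open>On \<open>real^'n^'n\<close> the library inner product is \<open>\<Sum>i j. C $ i $ j * P $ i $ j\<close>
  and the norm is the Frobenius norm.\<close>

definition transport_cost :: "real^'n^'n \<Rightarrow> real^'n \<Rightarrow> real^'n \<Rightarrow> real" where
  "transport_cost C x y = (INF P\<in>couplings x y. C \<bullet> P)"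

definition optimal_couplings :: "real^'n^'n \<Rightarrow> real^'n \<Rightarrow> real^'n \<Rightarrow> (real^'n^'n) set" where
  "optimal_couplings C x y = {P \<in> couplings x y. C \<bullet> P = transport_cost C x y}"

definition reg_functional ::
  "real^'n^'n \<Rightarrow> (real \<Rightarrow> real) \<Rightarrow> real \<Rightarrow> real^'n \<Rightarrow> real^'n \<Rightarrow> real^'n^'n \<Rightarrow> ereal" where
  "reg_functional C f \<gamma> x y P = ereal (C \<bullet> P) + ereal \<gamma> * bregman_mat f P (outer x y)"

text \<open>Existence and uniqueness of the couplings selected by the two definite descriptions
  below hold under the standing assumptions on \<open>f\<close>, for \<open>x, y\<close> in \<^const>\<open>prob_vectors\<close>
  and (for the first) \<open>\<gamma> > 0\<close>.\<close>

definition reg_coupling ::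
  "real^'n^'n \<Rightarrow> (real \<Rightarrow> real) \<Rightarrow> real \<Rightarrow> real^'n \<Rightarrow> real^'n \<Rightarrow> real^'n^'n" where
  "reg_coupling C f \<gamma> x y =
    (THE P. is_arg_min (reg_functional C f \<gamma> x y) (\<lambda>Q. Q \<in> couplings x y) P)"

definition reg_cost ::
  "real^'n^'n \<Rightarrow> (real \<Rightarrow> real) \<Rightarrow> real \<Rightarrow> real^'n \<Rightarrow> real^'n \<Rightarrow> real" where
  "reg_cost C f \<gamma> x y = C \<bullet> reg_coupling C f \<gamma> x y"

definition min_divergence ::
  "real^'n^'n \<Rightarrow> (real \<Rightarrow> real) \<Rightarrow> real^'n \<Rightarrow> real^'n \<Rightarrow> ereal" where
  "min_divergence C f x y = (INF P\<in>optimal_couplings C x y. bregman_mat f P (outer x y))"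

definition limit_coupling ::
  "real^'n^'n \<Rightarrow> (real \<Rightarrow> real) \<Rightarrow> real^'n \<Rightarrow> real^'n \<Rightarrow> real^'n^'n" where
  "limit_coupling C f x y =
    (THE P. P \<in> optimal_couplings C x y \<and>
            bregman_mat f P (outer x y) = min_divergence C f x y)"

end

theory Submission
  imports Defs
begin

text \<open>Replace \<open>\<gamma> \<in> [0,\<infinity>]\<close> by the weight \<open>\<theta> = \<gamma> / (1 + \<gamma>) \<in> [0,1]\<close> and minimize
  \<open>(1 - \<theta>) \<langle>C, \<Pi>\<rangle> + \<theta> D(\<Pi>)\<close> over \<open>\<Pi>(x,y)\<close>, where \<open>D(\<Pi>)\<close> is the divergence from \<open>x \<otimes> y\<close> and
  ties are broken as follows: among couplings of the same cost, \<open>D\<close> has to be smallest. Call such a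
  coupling selected. For \<open>0 < \<theta> < 1\<close> it is the regularized coupling,
  for \<open>\<theta> = 1\<close> it is \<open>x \<otimes> y\<close>, because \<open>D \<ge> 0\<close> with equality there, and for \<open>\<theta> = 0\<close> it is the
  optimal coupling of least divergence. By strict convexity it is unique for every \<open>\<theta>\<close>. All claims
  therefore say that one map, from \<open>(\<theta>, x, y) \<in> [0,1] \<times> P\<^sub>N \<times> P\<^sub>N\<close> to the selected coupling, is
  continuous. As couplings lie in a fixed compact ball, it is enough that its graph is closed.

  So let \<open>P\<^sub>n\<close> be selected for \<open>(\<theta>\<^sub>n, x\<^sub>n, y\<^sub>n)\<close> and converge to \<open>Q\<close>, and let \<open>R\<close> be a coupling of
  the limits \<open>x, y\<close>. A competitor of \<open>P\<^sub>n\<close> close to \<open>R\<close> is needed, but two things could go wrong.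
  First, where \<open>x\<^sub>i y\<^sub>j = 0\<close> the divergence of entries near the limit can blow up, since the slope of
  \<open>f\<close> at \<open>0\<close> may be \<open>-\<infinity>\<close>. Second, at \<open>\<theta> = 0\<close> the costs must be compared exactly, not only in the
  limit. Both problems vanish for the competitor \<open>S\<^sub>n = P\<^sub>n + t\<^sub>n (R - Q)\<close> with \<open>t\<^sub>n \<longlonglongrightarrow> 1\<close>: the matrix
  \<open>R - Q\<close> has zero marginals, so only nonnegativity restricts \<open>t\<^sub>n\<close>
  (\<open>coupling_displacement\<close>); it vanishes where \<open>x\<^sub>i y\<^sub>j = 0\<close>, so that the dangerous entries of \<open>S\<^sub>n\<close>
  and \<open>P\<^sub>n\<close> agree and cancel in \<open>D(S\<^sub>n) - D(P\<^sub>n) \<longlonglongrightarrow> D(R) - D(Q)\<close>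
  (\<open>tendsto_divergence_difference\<close>); and \<open>\<langle>C, S\<^sub>n\<rangle> = \<langle>C, P\<^sub>n\<rangle>\<close> whenever \<open>\<langle>C, R\<rangle> = \<langle>C, Q\<rangle>\<close>.
  Both conditions that define selection thus pass to the limit (\<open>selected_limit\<close>).\<close>

section \<open>Couplings of probability vectors\<close>

lemma closed_couplings: "closed (couplings x y)"
  unfolding couplings_def
  by (intro closed_Collect_conj closed_Collect_all closed_Collect_le closed_Collect_eq continuous_intros)

lemma closed_prob_vectors: "closed prob_vectors"
  unfolding prob_vectors_def
  by (intro closed_Collect_conj closed_Collect_all closed_Collect_le closed_Collect_eq continuous_intros)

lemma couplings_norm_le_1:
  assumes "x \<in> prob_vectors" "P \<in> couplings x y"
  shows "norm P \<le> 1"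
proof -
  have "norm P \<le> (\<Sum>i\<in>UNIV. norm (P $ i))"
    unfolding norm_vec_def by (rule L2_set_le_sum) simp
  also have "\<dots> \<le> (\<Sum>i\<in>UNIV. \<Sum>j\<in>UNIV. \<bar>P $ i $ j\<bar>)"
    by (intro sum_mono norm_le_l1_cart)
  also have "\<dots> = 1"
    using assms by (simp add: couplings_def prob_vectors_def)
  finally show ?thesis .
qed

lemma compact_couplings:
  assumes "x \<in> prob_vectors"
  shows "compact (couplings x y)"
  unfolding compact_eq_bounded_closed bounded_iff
  using couplings_norm_le_1[OF assms] closed_couplings by blast

lemma coupling_le_marginals:
  assumes "P \<in> couplings x y"
  shows "P $ i $ j \<le> x $ i" "P $ i $ j \<le> y $ j"
proof -
  have nonneg: "0 \<le> P $ a $ b" for a b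
    using assms by (simp add: couplings_def)
  have "P $ i $ j \<le> (\<Sum>k\<in>UNIV. P $ i $ k)"
    by (rule member_le_sum) (auto simp: nonneg)
  moreover have "P $ i $ j \<le> (\<Sum>k\<in>UNIV. P $ k $ j)"
    by (rule member_le_sum[where f = "\<lambda>k. P $ k $ j"]) (auto simp: nonneg)
  ultimately show "P $ i $ j \<le> x $ i" "P $ i $ j \<le> y $ j"
    using assms by (auto simp: couplings_def)
qed

lemma prob_vector_entry_le_1: "x \<in> prob_vectors \<Longrightarrow> x $ i \<le> 1"
  by (metis (mono_tags, lifting) UNIV_I finite_class.finite_UNIV mem_Collect_eq member_le_sum prob_vectors_def)

lemma coupling_entry_in_unit:
  assumes "x \<in> prob_vectors" "P \<in> couplings x y"
  shows "P $ i $ j \<in> {0..1}"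
  using assms coupling_le_marginals(1)[OF assms(2), of i j] prob_vector_entry_le_1[OF assms(1), of i]
  by (auto simp: couplings_def)

lemma outer_entry_in_unit:
  assumes "x \<in> prob_vectors" "y \<in> prob_vectors"
  shows "outer x y $ i $ j \<in> {0..1}"
  using assms prob_vector_entry_le_1[of x i] prob_vector_entry_le_1[of y j]
  by (auto simp: outer_def prob_vectors_def intro: mult_le_one)

lemma outer_in_couplings:
  assumes "x \<in> prob_vectors" "y \<in> prob_vectors"
  shows "outer x y \<in> couplings x y"
  using assms
  by (auto simp: couplings_def outer_def prob_vectors_def simp flip: sum_distrib_left sum_distrib_right)

text \<open>A coupling entry is bounded by both of its marginals, and one of them is zero. This is why the
  divergence from \<open>x \<otimes> y\<close> is finite on couplings even if \<open>f\<close> has slope \<open>-\<infinity>\<close> at \<open>0\<close>.\<close>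

lemma coupling_zero_where_outer_zero:
  assumes "x \<in> prob_vectors" "y \<in> prob_vectors" "P \<in> couplings x y" "outer x y $ i $ j = 0"
  shows "P $ i $ j = 0"
proof -
  have "0 \<le> P $ i $ j" using assms(3) by (simp add: couplings_def)
  then show ?thesis
    using assms(4) coupling_le_marginals[OF assms(3), of i j] by (auto simp: outer_def)
qed

lemma couplings_midpoint:
  assumes "P \<in> couplings x y" "R \<in> couplings x y"
  shows "(1/2) *\<^sub>R (P + R) \<in> couplings x y"
  using assms by (auto simp: couplings_def sum.distrib simp flip: sum_divide_distrib)

lemma couplings_limit:
  assumes P: "\<And>n. P n \<in> couplings (X n) (Y n)"
    and lim: "P \<longlonglongrightarrow> Q" "X \<longlonglongrightarrow> x" "Y \<longlonglongrightarrow> y"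
  shows "Q \<in> couplings x y"
proof -
  have "0 \<le> Q $ i $ j" for i j
    by (rule LIMSEQ_le_const[OF tendsto_vec_nth[OF tendsto_vec_nth[OF lim(1)]]])
       (use P in \<open>auto simp: couplings_def\<close>)
  moreover have "(\<Sum>k\<in>UNIV. Q $ i $ k) = x $ i" for i
  proof (rule LIMSEQ_unique)
    show "(\<lambda>n. \<Sum>k\<in>UNIV. P n $ i $ k) \<longlonglongrightarrow> (\<Sum>k\<in>UNIV. Q $ i $ k)"
      by (intro tendsto_intros lim)
    show "(\<lambda>n. \<Sum>k\<in>UNIV. P n $ i $ k) \<longlonglongrightarrow> x $ i"
      using P tendsto_vec_nth[OF lim(2), of i] by (simp add: couplings_def)
  qed
  moreover have "(\<Sum>k\<in>UNIV. Q $ k $ j) = y $ j" for j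
  proof (rule LIMSEQ_unique)
    show "(\<lambda>n. \<Sum>k\<in>UNIV. P n $ k $ j) \<longlonglongrightarrow> (\<Sum>k\<in>UNIV. Q $ k $ j)"
      by (intro tendsto_intros lim)
    show "(\<lambda>n. \<Sum>k\<in>UNIV. P n $ k $ j) \<longlonglongrightarrow> y $ j"
      using P tendsto_vec_nth[OF lim(3), of j] by (simp add: couplings_def)
  qed
  ultimately show ?thesis by (simp add: couplings_def)
qed

text \<open>A direction between two couplings of the limit marginals keeps all marginals fixed, so it can
  be followed from \<open>P n\<close> as long as no entry becomes negative. Only entries with \<open>Q $ i $ j > 0\<close> can
  decrease, and there \<open>P n\<close> is eventually close to \<open>Q\<close>, which allows steps of length nearly \<open>1\<close>.\<close>

lemma coupling_displacement:
  assumes P: "\<And>n. P n \<in> couplings (X n) (Y n)"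
    and lim: "P \<longlonglongrightarrow> Q"
    and Q: "Q \<in> couplings x y" and R: "R \<in> couplings x y"
  obtains t where "t \<longlonglongrightarrow> (1::real)"
    "\<And>n. P n + t n *\<^sub>R (R - Q) \<in> couplings (X n) (Y n)"
proof
  \<comment> \<open>\<open>d n\<close> bounds the largest relative error of \<open>P n\<close> against \<open>Q\<close>; entries with \<open>Q $ i $ j = 0\<close>
     contribute \<open>0\<close> since division by zero gives zero.\<close>
  define d where "d n = (\<Sum>i\<in>UNIV. \<Sum>j\<in>UNIV. \<bar>P n $ i $ j - Q $ i $ j\<bar> / Q $ i $ j)" for n
  define t where "t n = max 0 (1 - d n)" for n
  have "d \<longlonglongrightarrow> (\<Sum>i\<in>UNIV. \<Sum>j\<in>UNIV. \<bar>Q $ i $ j - Q $ i $ j\<bar> / Q $ i $ j)"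
    unfolding d_def divide_inverse by (intro tendsto_intros lim)
  then have "d \<longlonglongrightarrow> 0" by simp
  then have "t \<longlonglongrightarrow> max 0 (1 - 0)" unfolding t_def by (intro tendsto_intros)
  then show "t \<longlonglongrightarrow> 1" by simp
  fix n
  have t0: "0 \<le> t n" by (simp add: t_def)
  have nonneg: "0 \<le> P n $ i $ j" "0 \<le> Q $ i $ j" "0 \<le> R $ i $ j" for i j
    using P Q R by (auto simp: couplings_def)
  have shrink: "t n * Q $ i $ j \<le> P n $ i $ j" for i j
  proof (cases "Q $ i $ j = 0 \<or> t n = 0")
    case True
    then show ?thesis using nonneg by auto
  next
    case False
    then have q: "0 < Q $ i $ j" using nonneg(2)[of i j] by auto
    have "\<bar>P n $ i $ j - Q $ i $ j\<bar> / Q $ i $ j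
        \<le> (\<Sum>j\<in>UNIV. \<bar>P n $ i $ j - Q $ i $ j\<bar> / Q $ i $ j)"
      using nonneg by (intro member_le_sum) auto
    also have "\<dots> \<le> d n" unfolding d_def
      by (rule member_le_sum[where f = "\<lambda>i. \<Sum>j\<in>UNIV. \<bar>P n $ i $ j - Q $ i $ j\<bar> / Q $ i $ j"])
         (use nonneg in \<open>auto intro!: sum_nonneg\<close>)
    finally have "t n \<le> 1 - \<bar>P n $ i $ j - Q $ i $ j\<bar> / Q $ i $ j"
      using False by (auto simp: t_def max_def split: if_splits)
    then have "t n * Q $ i $ j \<le> (1 - \<bar>P n $ i $ j - Q $ i $ j\<bar> / Q $ i $ j) * Q $ i $ j"
      using q by (intro mult_right_mono) auto
    also have "\<dots> = Q $ i $ j - \<bar>P n $ i $ j - Q $ i $ j\<bar>" using q by (simp add: algebra_simps)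
    also have "\<dots> \<le> P n $ i $ j" by linarith
    finally show ?thesis .
  qed
  have "0 \<le> P n $ i $ j + t n * (R $ i $ j - Q $ i $ j)" for i j
    using shrink[of i j] mult_nonneg_nonneg[OF t0 nonneg(3)[of i j]] by (simp add: algebra_simps)
  then show "P n + t n *\<^sub>R (R - Q) \<in> couplings (X n) (Y n)"
    using P[of n] Q R
    by (auto simp: couplings_def sum.distrib sum_subtractf simp flip: sum_distrib_left)
qed

section \<open>The divergence from the product coupling\<close>

text \<open>The real form of the Bregman divergence on couplings: an entry with \<open>s = 0\<close> is only ever
  compared with \<open>r = 0\<close>, where the divergence vanishes by the convention \<open>\<plusminus>\<infinity> * 0 = 0\<close>.\<close>

definition entry_divergence :: "(real \<Rightarrow> real) \<Rightarrow> real \<Rightarrow> real \<Rightarrow> real" where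
  "entry_divergence f r s = (if s = 0 then 0 else f r - f s - slope f s * (r - s))"

definition divergence :: "(real \<Rightarrow> real) \<Rightarrow> real^'n^'n \<Rightarrow> real^'n^'n \<Rightarrow> real" where
  "divergence f P Q = (\<Sum>i\<in>UNIV. \<Sum>j\<in>UNIV. entry_divergence f (P $ i $ j) (Q $ i $ j))"

lemma bregman_mat_eq_divergence:
  assumes "x \<in> prob_vectors" "y \<in> prob_vectors" "P \<in> couplings x y"
  shows "bregman_mat f P (outer x y) = ereal (divergence f P (outer x y))"
proof -
  have "bregman f (P $ i $ j) (outer x y $ i $ j)
      = ereal (entry_divergence f (P $ i $ j) (outer x y $ i $ j))" for i j
    using coupling_zero_where_outer_zero[OF assms, of i j]
    by (auto simp: bregman_def entry_divergence_def slope_ext_def simp flip: zero_ereal_def)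
  then show ?thesis by (simp add: bregman_mat_def divergence_def)
qed

lemma strictly_convex_chord:
  assumes "strictly_convex_on S f" "r \<in> S" "s \<in> S" "0 \<le> t" "t \<le> (1::real)"
  shows "f ((1 - t) * r + t * s) \<le> (1 - t) * f r + t * f s"
proof (cases "r = s \<or> t = 0 \<or> t = 1")
  case True
  then show ?thesis by (auto simp: algebra_simps)
next
  case False
  then show ?thesis using assms unfolding strictly_convex_on_def
    by (metis less_eq_real_def)
qed

locale bregman_generator =
  fixes f :: "real \<Rightarrow> real"
  assumes strict: "strictly_convex_on {0..1} f"
    and cont: "continuous_on {0..1} f"
    and C1: "C1_on {0<..1} f"
begin

lemma slope_facts:
  shows has_slope: "r \<in> {0<..1} \<Longrightarrow> (f has_real_derivative slope f r) (at r within {0<..1})"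
    and continuous_on_slope: "continuous_on {0<..1} (slope f)"
proof -
  obtain f' where f': "continuous_on {0<..1} f'"
    "\<And>r. r \<in> {0<..1} \<Longrightarrow> (f has_real_derivative f' r) (at r within {0<..1})"
    using C1 unfolding C1_on_def by blast
  have eq: "slope f r = f' r" if r: "r \<in> {0<..1}" for r
    unfolding slope_def
  proof (rule vector_derivative_within)
    have "r islimpt {0<..<r}" using r by (intro islimpt_greaterThanLessThan2) auto
    then have "r islimpt {0<..1}" by (rule islimpt_subset) (use r in auto)
    then show "at r within {0<..1} \<noteq> bot" by (simp add: trivial_limit_within)
    show "(f has_vector_derivative f' r) (at r within {0<..1})"
      using f'(2)[OF r] by (simp add: has_real_derivative_iff_has_vector_derivative)
  qed
  show "r \<in> {0<..1} \<Longrightarrow> (f has_real_derivative slope f r) (at r within {0<..1})"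
    using f'(2) eq by metis
  show "continuous_on {0<..1} (slope f)"
    using f'(1) eq by (metis (no_types, lifting) continuous_on_cong)
qed

text \<open>The graph of a convex function lies above its tangent at \<open>s\<close>: the difference quotients along
  the segment from \<open>s\<close> to \<open>r\<close> are at most \<open>f r - f s\<close>, and their limit at \<open>s\<close> is
  \<open>slope f s * (r - s)\<close>. Working along the segment also covers \<open>s = 1\<close>, where \<open>f\<close> has only a
  one-sided derivative, and \<open>r = 0\<close>, where it may have none.\<close>

lemma entry_divergence_nonneg:
  assumes r: "r \<in> {0..1}" and s: "s \<in> {0..1}"
  shows "0 \<le> entry_divergence f r s"
proof (cases "s = 0")
  case True
  then show ?thesis by (simp add: entry_divergence_def)
next
  case False
  then have s1: "s \<in> {0<..1}" using s by auto
  define g where "g h = f (s + h * (r - s))" for h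
  have in1: "s + h * (r - s) \<in> {0<..1}" if h: "h \<in> {0..<1}" for h
  proof -
    have "s + h * (r - s) = (1 - h) * s + h * r" by (simp add: algebra_simps)
    moreover have "0 < (1 - h) * s" "0 \<le> h * r" using h s1 r by auto
    moreover have "(1 - h) * s + h * r \<le> 1" using h s1 r convex_bound_le[of s 1 r "1 - h" h] by auto
    ultimately show ?thesis by auto
  qed
  have "((f \<circ> (\<lambda>h. s + h * (r - s))) has_real_derivative slope f s * (r - s)) (at 0 within {0..<1})"
  proof (rule DERIV_image_chain)
    show "((\<lambda>h. s + h * (r - s)) has_real_derivative (r - s)) (at 0 within {0..<1})"
      by (auto intro!: derivative_eq_intros)
    have "(f has_real_derivative slope f s) (at s within (\<lambda>h. s + h * (r - s)) ` {0..<1})"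
      using has_slope[OF s1] by (rule DERIV_subset) (use in1 in auto)
    then show "(f has_real_derivative slope f s)
        (at (s + 0 * (r - s)) within (\<lambda>h. s + h * (r - s)) ` {0..<1})"
      by simp
  qed
  then have "((\<lambda>h. (f (s + h * (r - s)) - f s) / h) \<longlongrightarrow> slope f s * (r - s)) (at 0 within {0..<1})"
    by (simp add: has_field_derivative_iff o_def)
  moreover have "\<forall>\<^sub>F h in at 0 within {0..<1}. (f (s + h * (r - s)) - f s) / h \<le> f r - f s"
  proof -
    have "(f (s + h * (r - s)) - f s) / h \<le> f r - f s" if "h \<in> {0<..<1}" for h
    proof -
      have "f (s + h * (r - s)) \<le> (1 - h) * f s + h * f r"
        using strictly_convex_chord[OF strict s r, of h] that by (simp add: algebra_simps)
      then show ?thesis using that by (simp add: field_simps)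
    qed
    then show ?thesis by (auto simp: eventually_at_filter)
  qed
  moreover have "at (0::real) within {0..<1} \<noteq> bot"
    using islimpt_subset[OF islimpt_greaterThanLessThan1[of 0 "1::real"], of "{0..<1}"]
    by (auto simp: trivial_limit_within)
  ultimately have "slope f s * (r - s) \<le> f r - f s"
    by (intro tendsto_upperbound)
  then show ?thesis using False by (simp add: entry_divergence_def)
qed

lemma entry_divergence_midpoint:
  assumes "r \<in> {0..1}" "r' \<in> {0..1}"
  shows "2 * entry_divergence f ((r + r') / 2) s \<le> entry_divergence f r s + entry_divergence f r' s"
    and "r \<noteq> r' \<Longrightarrow> s \<noteq> 0 \<Longrightarrow>
      2 * entry_divergence f ((r + r') / 2) s < entry_divergence f r s + entry_divergence f r' s"
proof -
  have m: "(1 - 1/2) * r + 1/2 * r' = (r + r') / 2" by (simp add: field_simps)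
  have "2 * f ((r + r') / 2) \<le> f r + f r'"
    using strictly_convex_chord[OF strict assms, of "1/2"] unfolding m by simp
  then show "2 * entry_divergence f ((r + r') / 2) s \<le> entry_divergence f r s + entry_divergence f r' s"
    by (simp add: entry_divergence_def field_simps)
  assume ne: "r \<noteq> r'" "s \<noteq> 0"
  have "f ((1 - 1/2) * r + 1/2 * r') < (1 - 1/2) * f r + 1/2 * f r'"
    using strict assms ne(1) unfolding strictly_convex_on_def
    by (metis half_gt_zero_iff field_sum_of_halves less_add_same_cancel1 zero_less_one)
  then have "2 * f ((r + r') / 2) < f r + f r'" unfolding m by simp
  then show "2 * entry_divergence f ((r + r') / 2) s < entry_divergence f r s + entry_divergence f r' s"
    using ne by (simp add: entry_divergence_def field_simps)
qed

text \<open>Distinct couplings differ at an entry where the product is positive, and there the divergence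
  is strictly convex because it is \<open>f\<close> plus an affine function.\<close>

lemma divergence_midpoint:
  assumes xy: "x \<in> prob_vectors" "y \<in> prob_vectors"
    and P: "P \<in> couplings x y" and R: "R \<in> couplings x y" and ne: "P \<noteq> R"
  shows "2 * divergence f ((1/2) *\<^sub>R (P + R)) (outer x y)
    < divergence f P (outer x y) + divergence f R (outer x y)"
proof -
  note unit = coupling_entry_in_unit[OF xy(1) P] coupling_entry_in_unit[OF xy(1) R]
  obtain i j where ij: "P $ i $ j \<noteq> R $ i $ j" using ne by (auto simp: vec_eq_iff)
  then have o: "outer x y $ i $ j \<noteq> 0"
    using coupling_zero_where_outer_zero[OF xy P] coupling_zero_where_outer_zero[OF xy R] by metis
  let ?E = "\<lambda>P i j. entry_divergence f (P $ i $ j) (outer x y $ i $ j)"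
  let ?M = "(1/2) *\<^sub>R (P + R)"
  have le: "2 * ?E ?M a b \<le> ?E P a b + ?E R a b" for a b
    using entry_divergence_midpoint(1)[OF unit] by simp
  have lt: "2 * ?E ?M i j < ?E P i j + ?E R i j"
    using entry_divergence_midpoint(2)[OF unit ij o] by simp
  have "(\<Sum>a\<in>UNIV. \<Sum>b\<in>UNIV. 2 * ?E ?M a b) < (\<Sum>a\<in>UNIV. \<Sum>b\<in>UNIV. ?E P a b + ?E R a b)"
  proof (rule sum_strict_mono_ex1)
    show "\<exists>a\<in>UNIV. (\<Sum>b\<in>UNIV. 2 * ?E ?M a b) < (\<Sum>b\<in>UNIV. ?E P a b + ?E R a b)"
    proof
      show "(\<Sum>b\<in>UNIV. 2 * ?E ?M i b) < (\<Sum>b\<in>UNIV. ?E P i b + ?E R i b)"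
        using le lt by (intro sum_strict_mono_ex1) auto
    qed simp
  qed (auto intro!: sum_mono le simp del: vector_scaleR_component vector_add_component)
  then show ?thesis
    by (simp add: divergence_def sum.distrib sum_distrib_left)
qed

lemma divergence_outer_le:
  assumes xy: "x \<in> prob_vectors" "y \<in> prob_vectors" and P: "P \<in> couplings x y"
  shows "divergence f (outer x y) (outer x y) \<le> divergence f P (outer x y)"
proof -
  have "divergence f (outer x y) (outer x y) = 0"
    unfolding divergence_def by (intro sum.neutral ballI) (simp add: entry_divergence_def)
  moreover have "0 \<le> divergence f P (outer x y)"
    unfolding divergence_def
    by (intro sum_nonneg entry_divergence_nonneg coupling_entry_in_unit[OF xy(1) P] outer_entry_in_unit[OF xy])
  ultimately show ?thesis by simp
qed

lemma continuous_on_divergence: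
  assumes "x \<in> prob_vectors"
  shows "continuous_on (couplings x y) (\<lambda>P. divergence f P (outer x y))"
proof -
  have "continuous_on (couplings x y) (\<lambda>P. entry_divergence f (P $ i $ j) s)" for i j s
    unfolding entry_divergence_def
    by (cases "s = 0"; simp; intro continuous_intros continuous_on_compose2[OF cont])
       (use coupling_entry_in_unit[OF assms] in auto)
  then show ?thesis unfolding divergence_def by (intro continuous_intros)
qed

lemma tendsto_entry_divergence:
  assumes "r \<longlonglongrightarrow> r0" "\<And>n. r n \<in> {0..1}" "s \<longlonglongrightarrow> s0" "\<And>n. s n \<in> {0..1}" "s0 \<noteq> 0"
  shows "(\<lambda>n. entry_divergence f (r n) (s n)) \<longlonglongrightarrow> entry_divergence f r0 s0"
proof -
  have unit: "r0 \<in> {0..1}" "s0 \<in> {0..1}"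
    using closed_sequentially[OF closed_atLeastAtMost] assms by metis+
  have pos: "\<forall>\<^sub>F n in sequentially. 0 < s n"
    using assms(5) unit by (intro order_tendstoD(1)[OF assms(3)]) auto
  have "(\<lambda>n. f (r n)) \<longlonglongrightarrow> f r0" "(\<lambda>n. f (s n)) \<longlonglongrightarrow> f s0"
    using assms unit by (auto intro!: continuous_on_tendsto_compose[OF cont])
  moreover have "(\<lambda>n. slope f (s n)) \<longlonglongrightarrow> slope f s0"
    using pos assms(4,5) unit
    by (intro continuous_on_tendsto_compose[OF continuous_on_slope assms(3)])
       (auto elim!: eventually_mono)
  ultimately have "(\<lambda>n. f (r n) - f (s n) - slope f (s n) * (r n - s n))
      \<longlonglongrightarrow> f r0 - f s0 - slope f s0 * (r0 - s0)"
    by (intro tendsto_intros assms)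
  moreover have "\<forall>\<^sub>F n in sequentially. f (r n) - f (s n) - slope f (s n) * (r n - s n)
      = entry_divergence f (r n) (s n)"
    using pos by eventually_elim (simp add: entry_divergence_def)
  ultimately show ?thesis
    using assms(5) Lim_transform_eventually by (fastforce simp: entry_divergence_def[of f r0 s0])
qed


text \<open>The two divergences need not converge separately: where the limit product is zero their
  entries may be unbounded. But there \<open>R\<close> and \<open>Q\<close> are both zero, so the entries of the two couplings
  coincide and cancel; at every other entry the divergence is jointly continuous.\<close>

lemma tendsto_divergence_difference:
  assumes X: "\<And>n. X n \<in> prob_vectors" "X \<longlonglongrightarrow> x" "x \<in> prob_vectors"
    and Y: "\<And>n. Y n \<in> prob_vectors" "Y \<longlonglongrightarrow> y" "y \<in> prob_vectors"
    and P: "\<And>n. P n \<in> couplings (X n) (Y n)" "P \<longlonglongrightarrow> Q"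
    and S: "\<And>n. P n + t n *\<^sub>R (R - Q) \<in> couplings (X n) (Y n)" "t \<longlonglongrightarrow> 1"
    and Q: "Q \<in> couplings x y" and R: "R \<in> couplings x y"
  shows "(\<lambda>n. divergence f (P n + t n *\<^sub>R (R - Q)) (outer (X n) (Y n)) - divergence f (P n) (outer (X n) (Y n)))
    \<longlonglongrightarrow> divergence f R (outer x y) - divergence f Q (outer x y)"
proof -
  have "(\<lambda>n. entry_divergence f ((P n + t n *\<^sub>R (R - Q)) $ i $ j) (outer (X n) (Y n) $ i $ j)
        - entry_divergence f (P n $ i $ j) (outer (X n) (Y n) $ i $ j))
      \<longlonglongrightarrow> entry_divergence f (R $ i $ j) (outer x y $ i $ j)
        - entry_divergence f (Q $ i $ j) (outer x y $ i $ j)" for i j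
  proof (cases "outer x y $ i $ j = 0")
    case True
    then have "R $ i $ j = 0" "Q $ i $ j = 0"
      using coupling_zero_where_outer_zero[OF X(3) Y(3)] Q R by blast+
    then show ?thesis by simp
  next
    case False
    have outer_lim: "(\<lambda>n. outer (X n) (Y n) $ i $ j) \<longlonglongrightarrow> outer x y $ i $ j"
      unfolding outer_def by (auto intro!: tendsto_intros X Y)
    have "(\<lambda>n. (P n + t n *\<^sub>R (R - Q)) $ i $ j) \<longlonglongrightarrow> (Q + 1 *\<^sub>R (R - Q)) $ i $ j"
      by (intro tendsto_intros P S)
    then have S_lim: "(\<lambda>n. (P n + t n *\<^sub>R (R - Q)) $ i $ j) \<longlonglongrightarrow> R $ i $ j" by simp
    have P_lim: "(\<lambda>n. P n $ i $ j) \<longlonglongrightarrow> Q $ i $ j" by (intro tendsto_intros P)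
    show ?thesis
      by (intro tendsto_diff
          tendsto_entry_divergence[OF S_lim coupling_entry_in_unit[OF X(1) S(1)]
            outer_lim outer_entry_in_unit[OF X(1) Y(1)] False]
          tendsto_entry_divergence[OF P_lim coupling_entry_in_unit[OF X(1) P(1)]
            outer_lim outer_entry_in_unit[OF X(1) Y(1)] False])
  qed
  then show ?thesis
    unfolding divergence_def sum_subtractf[symmetric] by (intro tendsto_sum)
qed

section \<open>Minimizers with ties broken by the divergence\<close>

text \<open>At \<open>\<theta> = 0\<close> the tie rule picks the optimal coupling of least divergence. Imposing it for every
  \<open>\<theta>\<close> makes it available along a sequence \<open>\<theta> \<longlonglongrightarrow> 0\<close>, and hence at its limit.\<close>

definition selected :: "real^'n^'n \<Rightarrow> real \<Rightarrow> real^'n \<Rightarrow> real^'n \<Rightarrow> real^'n^'n \<Rightarrow> bool" where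
  "selected C \<theta> x y P \<longleftrightarrow> P \<in> couplings x y \<and>
    (\<forall>S\<in>couplings x y.
      (1 - \<theta>) * (C \<bullet> P) + \<theta> * divergence f P (outer x y)
        \<le> (1 - \<theta>) * (C \<bullet> S) + \<theta> * divergence f S (outer x y) \<and>
      (C \<bullet> S = C \<bullet> P \<longrightarrow> divergence f P (outer x y) \<le> divergence f S (outer x y)))"

text \<open>Both conditions are tested against \<open>P n + t n *\<^sub>R (R - Q)\<close>. Its cost exceeds that of \<open>P n\<close> by
  \<open>t n * (C \<bullet> R - C \<bullet> Q)\<close>. So if \<open>R\<close> and \<open>Q\<close> have the same cost, then the tie rule applies for each
  \<open>n\<close> and passes to the limit, at whatever rate \<open>\<theta>\<close> tends to zero.\<close>

lemma selected_limit:
  assumes X: "\<And>n. X n \<in> prob_vectors" "X \<longlonglongrightarrow> x" "x \<in> prob_vectors"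
    and Y: "\<And>n. Y n \<in> prob_vectors" "Y \<longlonglongrightarrow> y" "y \<in> prob_vectors"
    and \<theta>: "\<theta> \<longlonglongrightarrow> \<tau>"
    and P: "\<And>n. selected C (\<theta> n) (X n) (Y n) (P n)" "P \<longlonglongrightarrow> Q"
  shows "selected C \<tau> x y Q"
proof -
  have Pc: "P n \<in> couplings (X n) (Y n)" for n
    using P(1) by (simp add: selected_def)
  have Q: "Q \<in> couplings x y"
    using couplings_limit[OF Pc P(2) X(2) Y(2)] .
  let ?D = "\<lambda>R. divergence f R (outer x y)"
  have "(1 - \<tau>) * (C \<bullet> Q) + \<tau> * ?D Q \<le> (1 - \<tau>) * (C \<bullet> R) + \<tau> * ?D R \<and>
      (C \<bullet> R = C \<bullet> Q \<longrightarrow> ?D Q \<le> ?D R)" if R: "R \<in> couplings x y" for R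
  proof -
    obtain t where t: "t \<longlonglongrightarrow> 1" "\<And>n. P n + t n *\<^sub>R (R - Q) \<in> couplings (X n) (Y n)"
      using coupling_displacement[OF Pc P(2) Q R] by blast
    define S where "S n = P n + t n *\<^sub>R (R - Q)" for n
    let ?Dn = "\<lambda>n R. divergence f R (outer (X n) (Y n))"
    have lim: "(\<lambda>n. ?Dn n (S n) - ?Dn n (P n)) \<longlonglongrightarrow> ?D R - ?D Q"
      unfolding S_def by (rule tendsto_divergence_difference[OF X Y Pc P(2) t(2,1) Q R])
    have cost: "C \<bullet> S n - C \<bullet> P n = t n * (C \<bullet> R - C \<bullet> Q)" for n
      by (simp add: S_def inner_right_distrib inner_diff_right)
    have sel: "(1 - \<theta> n) * (C \<bullet> P n) + \<theta> n * ?Dn n (P n)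
          \<le> (1 - \<theta> n) * (C \<bullet> S n) + \<theta> n * ?Dn n (S n) \<and>
        (C \<bullet> S n = C \<bullet> P n \<longrightarrow> ?Dn n (P n) \<le> ?Dn n (S n))" for n
      using P(1)[of n] t(2)[of n] by (auto simp: selected_def S_def)
    have "0 \<le> (1 - \<theta> n) * (t n * (C \<bullet> R - C \<bullet> Q)) + \<theta> n * (?Dn n (S n) - ?Dn n (P n))" for n
      using sel[of n] unfolding cost[symmetric] by (simp add: algebra_simps)
    moreover have "(\<lambda>n. (1 - \<theta> n) * (t n * (C \<bullet> R - C \<bullet> Q)) + \<theta> n * (?Dn n (S n) - ?Dn n (P n)))
        \<longlonglongrightarrow> (1 - \<tau>) * (1 * (C \<bullet> R - C \<bullet> Q)) + \<tau> * (?D R - ?D Q)"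
      by (intro tendsto_intros \<theta> t(1) lim)
    ultimately have "0 \<le> (1 - \<tau>) * (1 * (C \<bullet> R - C \<bullet> Q)) + \<tau> * (?D R - ?D Q)"
      by (intro LIMSEQ_le_const) auto
    moreover have "?D Q \<le> ?D R" if eq: "C \<bullet> R = C \<bullet> Q"
    proof -
      have "0 \<le> ?Dn n (S n) - ?Dn n (P n)" for n
        using sel[of n] cost[of n] eq by simp
      then have "0 \<le> ?D R - ?D Q" using lim by (intro LIMSEQ_le_const) auto
      then show ?thesis by simp
    qed
    ultimately show ?thesis by (simp add: algebra_simps)
  qed
  then show ?thesis using Q by (simp add: selected_def)
qed

lemma selected_unique:
  assumes xy: "x \<in> prob_vectors" "y \<in> prob_vectors" and \<theta>: "0 \<le> \<theta>"
    and P: "selected C \<theta> x y P" and R: "selected C \<theta> x y R"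
  shows "P = R"
proof (rule ccontr)
  assume ne: "P \<noteq> R"
  have c: "P \<in> couplings x y" "R \<in> couplings x y"
    using P R by (auto simp: selected_def)
  define M where "M = (1/2) *\<^sub>R (P + R)"
  have M: "M \<in> couplings x y" unfolding M_def using couplings_midpoint[OF c] .
  let ?D = "\<lambda>R. divergence f R (outer x y)"
  have D: "2 * ?D M < ?D P + ?D R" unfolding M_def using divergence_midpoint[OF xy c ne] .
  have C: "2 * (C \<bullet> M) = C \<bullet> P + C \<bullet> R" by (simp add: M_def inner_right_distrib)
  have G: "(1 - \<theta>) * (C \<bullet> P) + \<theta> * ?D P = (1 - \<theta>) * (C \<bullet> R) + \<theta> * ?D R"
    "(1 - \<theta>) * (C \<bullet> P) + \<theta> * ?D P \<le> (1 - \<theta>) * (C \<bullet> M) + \<theta> * ?D M"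
    using P R c M by (auto simp: selected_def intro: antisym)
  show False
  proof (cases "\<theta> = 0")
    case True
    then have "C \<bullet> P = C \<bullet> R" using G by simp
    moreover from this have "C \<bullet> M = C \<bullet> P" using C by simp
    ultimately have "?D P \<le> ?D M" "?D R \<le> ?D M"
      using P R M by (auto simp: selected_def)
    then show False using D by simp
  next
    case False
    then have "\<theta> * (2 * ?D M) < \<theta> * (?D P + ?D R)" using D \<theta> by simp
    moreover have "(1 - \<theta>) * (2 * (C \<bullet> M)) = (1 - \<theta>) * (C \<bullet> P + C \<bullet> R)" using C by simp
    ultimately show False using G by (simp add: algebra_simps)
  qed
qed

text \<open>Minimize twice: first the weighted sum over the compact set of couplings, then the divergence
  over the compact set of its minimizers.\<close>

lemma selected_exists:
  assumes xy: "x \<in> prob_vectors" "y \<in> prob_vectors" and \<theta>: "0 \<le> \<theta>"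
  obtains P where "selected C \<theta> x y P"
proof -
  let ?D = "\<lambda>R. divergence f R (outer x y)"
  let ?G = "\<lambda>R. (1 - \<theta>) * (C \<bullet> R) + \<theta> * ?D R"
  note comp = compact_couplings[OF xy(1), of y]
  note contD = continuous_on_divergence[OF xy(1), of y]
  have ne: "couplings x y \<noteq> {}" using outer_in_couplings[OF xy] by blast
  have contG: "continuous_on (couplings x y) ?G"
    by (intro continuous_intros contD)
  obtain P where P: "P \<in> couplings x y" "\<And>S. S \<in> couplings x y \<Longrightarrow> ?G P \<le> ?G S"
    using continuous_attains_inf[OF comp ne contG] by blast
  define A where "A = {S \<in> couplings x y. ?G S = ?G P}"
  have "closed A"
    unfolding A_def by (intro continuous_closed_preimage_constant contG closed_couplings)
  moreover have sub: "A \<subseteq> couplings x y" by (simp add: A_def)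
  ultimately have compA: "compact A"
    using compact_Int_closed[OF comp, of A] by (simp add: inf.absorb2)
  have neA: "A \<noteq> {}" using P(1) by (auto simp: A_def)
  obtain R where R: "R \<in> A" "\<And>S. S \<in> A \<Longrightarrow> ?D R \<le> ?D S"
    using continuous_attains_inf[OF compA neA continuous_on_subset[OF contD sub]] by blast
  have "?G R \<le> ?G S \<and> (C \<bullet> S = C \<bullet> R \<longrightarrow> ?D R \<le> ?D S)" if S: "S \<in> couplings x y" for S
  proof
    show le: "?G R \<le> ?G S" using R(1) P(2)[OF S] by (simp add: A_def)
    show "C \<bullet> S = C \<bullet> R \<longrightarrow> ?D R \<le> ?D S"
    proof (cases "\<theta> = 0")
      case True
      then show ?thesis using R S by (auto simp: A_def)
    next
      case False
      then show ?thesis using le \<theta> by auto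
    qed
  qed
  moreover have "R \<in> couplings x y" using R(1) sub by blast
  ultimately have "selected C \<theta> x y R" by (simp add: selected_def)
  then show thesis by (rule that)
qed

text \<open>The arguments are tupled so that joint continuity in \<open>(\<theta>, x, y)\<close> can be stated.\<close>

definition selection :: "real^'n^'n \<Rightarrow> real \<times> (real^'n) \<times> (real^'n) \<Rightarrow> real^'n^'n" where
  "selection C = (\<lambda>(\<theta>, x, y). THE P. selected C \<theta> x y P)"

lemma selection_eqI:
  assumes "x \<in> prob_vectors" "y \<in> prob_vectors" "0 \<le> \<theta>" "selected C \<theta> x y P"
  shows "selection C (\<theta>, x, y) = P"
  unfolding selection_def prod.case
  by (rule the_equality) (fact assms(4), rule selected_unique[OF assms(1-3) _ assms(4)])

lemma selected_selection:
  assumes "x \<in> prob_vectors" "y \<in> prob_vectors" "0 \<le> \<theta>"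
  shows "selected C \<theta> x y (selection C (\<theta>, x, y))"
  by (metis assms selected_exists selection_eqI)

text \<open>A map into a compact set with closed graph is continuous; the graph is closed because limits of
  selected couplings are selected, and selected couplings are unique.\<close>

lemma continuous_on_selection:
  "continuous_on ({0..1} \<times> prob_vectors \<times> prob_vectors) (selection C)"
proof (rule continuous_from_closed_graph)
  let ?S = "{0..1::real} \<times> prob_vectors \<times> prob_vectors"
  have sel: "selected C \<theta> x y (selection C (\<theta>, x, y))" if "(\<theta>, x, y) \<in> ?S" for \<theta> x y
    using that selected_selection by auto
  show "compact (cball 0 1 :: (real^'a^'a) set)" by simp
  show "selection C \<in> ?S \<rightarrow> cball 0 1"
    using sel couplings_norm_le_1 by (fastforce simp: selected_def)
  have closed_S: "closed ?S" by (intro closed_Times closed_prob_vectors closed_atLeastAtMost)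
  show "closed ((\<lambda>p. (p, selection C p)) ` ?S)"
    unfolding closed_sequential_limits
  proof (intro allI impI, elim conjE)
    fix g l assume g: "\<forall>n. g n \<in> (\<lambda>p. (p, selection C p)) ` ?S" and lim: "g \<longlonglongrightarrow> l"
    obtain \<tau> x y Q where l: "l = ((\<tau>, x, y), Q)" by (metis prod_cases3 surj_pair)
    define \<theta> X Y P where "\<theta> n = fst (fst (g n))" and "X n = fst (snd (fst (g n)))"
      and "Y n = snd (snd (fst (g n)))" and "P n = snd (g n)" for n
    have lims: "\<theta> \<longlonglongrightarrow> \<tau>" "X \<longlonglongrightarrow> x" "Y \<longlonglongrightarrow> y" "P \<longlonglongrightarrow> Q" "(\<lambda>n. fst (g n)) \<longlonglongrightarrow> (\<tau>, x, y)"
      unfolding \<theta>_def X_def Y_def P_def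
      using tendsto_fst[OF lim] tendsto_snd[OF lim]
        tendsto_fst[OF tendsto_fst[OF lim]] tendsto_snd[OF tendsto_fst[OF lim]]
        tendsto_fst[OF tendsto_snd[OF tendsto_fst[OF lim]]]
        tendsto_snd[OF tendsto_snd[OF tendsto_fst[OF lim]]] l by auto
    have g': "fst (g n) \<in> ?S" "snd (g n) = selection C (fst (g n))" for n
      using g by (metis (no_types, lifting) fst_conv imageE snd_conv)+
    have inS: "(\<tau>, x, y) \<in> ?S"
      by (rule closed_sequentially[OF closed_S g'(1) lims(5)])
    have gn: "(\<theta> n, X n, Y n) \<in> ?S" "P n = selection C (\<theta> n, X n, Y n)" for n
      using g'[of n] by (simp_all add: \<theta>_def X_def Y_def P_def)
    have "selected C \<tau> x y Q"
    proof (rule selected_limit)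
      show "selected C (\<theta> n) (X n) (Y n) (P n)" for n using sel gn by simp
    qed (use lims gn(1) inS in auto)
    moreover have "selection C (\<tau>, x, y) = Q"
      using inS calculation by (intro selection_eqI) auto
    ultimately show "l \<in> (\<lambda>p. (p, selection C p)) ` ?S" using inS l by blast
  qed
qed

lemma selection_1:
  assumes xy: "x \<in> prob_vectors" "y \<in> prob_vectors"
  shows "selection C (1, x, y) = outer x y"
  using divergence_outer_le[OF xy] outer_in_couplings[OF xy]
  by (intro selection_eqI xy) (auto simp: selected_def)

text \<open>Dividing \<open>\<langle>C, \<Pi>\<rangle> + \<gamma> D(\<Pi>)\<close> by \<open>1 + \<gamma> > 0\<close> gives the weighted sum, and the tie rule holds
  because \<open>\<gamma> > 0\<close>.\<close>

lemma selection_eq_reg_coupling: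
  assumes xy: "x \<in> prob_vectors" "y \<in> prob_vectors" and \<gamma>: "0 < \<gamma>"
  shows "selection C (\<gamma> / (1 + \<gamma>), x, y) = reg_coupling C f \<gamma> x y"
proof -
  let ?D = "\<lambda>R. divergence f R (outer x y)"
  let ?\<theta> = "\<gamma> / (1 + \<gamma>)"
  have reg: "reg_functional C f \<gamma> x y P = ereal (C \<bullet> P + \<gamma> * ?D P)" if "P \<in> couplings x y" for P
    using bregman_mat_eq_divergence[OF xy that] by (simp add: reg_functional_def)
  have weight: "(1 - ?\<theta>) * c + ?\<theta> * d = (c + \<gamma> * d) / (1 + \<gamma>)" for c d
  proof -
    have "1 - ?\<theta> = 1 / (1 + \<gamma>)" using \<gamma> by (simp add: field_simps)
    then show ?thesis by (simp add: add_divide_distrib)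
  qed
  have "is_arg_min (reg_functional C f \<gamma> x y) (\<lambda>Q. Q \<in> couplings x y) P \<longleftrightarrow> selected C ?\<theta> x y P" for P
  proof -
    have "is_arg_min (reg_functional C f \<gamma> x y) (\<lambda>Q. Q \<in> couplings x y) P \<longleftrightarrow>
        P \<in> couplings x y \<and> (\<forall>S\<in>couplings x y. C \<bullet> P + \<gamma> * ?D P \<le> C \<bullet> S + \<gamma> * ?D S)"
      by (auto simp: is_arg_min_def reg not_less)
    also have "\<dots> \<longleftrightarrow> selected C ?\<theta> x y P"
      unfolding selected_def weight using \<gamma> by (fastforce simp: divide_le_cancel)
    finally show ?thesis .
  qed
  then show ?thesis by (simp add: reg_coupling_def selection_def)
qed

lemma selection_eq_limit_coupling:
  assumes xy: "x \<in> prob_vectors" "y \<in> prob_vectors"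
  shows "selection C (0, x, y) = limit_coupling C f x y"
proof -
  let ?D = "\<lambda>R. divergence f R (outer x y)"
  have ne: "couplings x y \<noteq> {}" using outer_in_couplings[OF xy] by blast
  have bdd: "bdd_below ((\<lambda>P. C \<bullet> P) ` couplings x y)"
    by (intro bounded_imp_bdd_below compact_imp_bounded compact_continuous_image
        compact_couplings[OF xy(1)] continuous_intros)
  have opt: "P \<in> optimal_couplings C x y \<longleftrightarrow>
      P \<in> couplings x y \<and> (\<forall>S\<in>couplings x y. C \<bullet> P \<le> C \<bullet> S)" for P
  proof -
    have "C \<bullet> P = transport_cost C x y \<longleftrightarrow> (\<forall>S\<in>couplings x y. C \<bullet> P \<le> C \<bullet> S)"
      if P: "P \<in> couplings x y"
    proof
      assume "C \<bullet> P = transport_cost C x y"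
      then show "\<forall>S\<in>couplings x y. C \<bullet> P \<le> C \<bullet> S"
        using cINF_lower[OF bdd] by (simp add: transport_cost_def)
    next
      assume "\<forall>S\<in>couplings x y. C \<bullet> P \<le> C \<bullet> S"
      then have "C \<bullet> P \<le> transport_cost C x y"
        unfolding transport_cost_def by (intro cINF_greatest ne) auto
      then show "C \<bullet> P = transport_cost C x y"
        using cINF_lower[OF bdd P] by (simp add: transport_cost_def)
    qed
    then show ?thesis by (auto simp: optimal_couplings_def)
  qed
  have div: "bregman_mat f P (outer x y) = ereal (?D P)" if "P \<in> optimal_couplings C x y" for P
    using bregman_mat_eq_divergence[OF xy] that opt by blast
  have "P \<in> optimal_couplings C x y \<and> bregman_mat f P (outer x y) = min_divergence C f x y
      \<longleftrightarrow> selected C 0 x y P" for P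
  proof -
    have "bregman_mat f P (outer x y) = min_divergence C f x y \<longleftrightarrow>
        (\<forall>S\<in>optimal_couplings C x y. bregman_mat f P (outer x y) \<le> bregman_mat f S (outer x y))"
      if "P \<in> optimal_couplings C x y"
      using that unfolding min_divergence_def
      by (auto intro: INF_lower intro!: antisym INF_greatest)
    then have "P \<in> optimal_couplings C x y \<and> bregman_mat f P (outer x y) = min_divergence C f x y
        \<longleftrightarrow> P \<in> optimal_couplings C x y \<and> (\<forall>S\<in>optimal_couplings C x y. ?D P \<le> ?D S)"
      using div by auto
    also have "\<dots> \<longleftrightarrow> selected C 0 x y P"
      unfolding selected_def using opt by (fastforce intro: antisym)
    finally show ?thesis .
  qed
  then show ?thesis by (simp add: limit_coupling_def selection_def)
qed

end

section \<open>Passing from the weight to the regularization parameter\<close>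

text \<open>This is \<open>\<gamma> / (1 + \<gamma>)\<close>, written so that it takes the value \<open>1\<close> at \<open>\<infinity>\<close> and its continuity
  there comes from that of \<^const>\<open>inverse\<close> on the nonnegative extended reals.\<close>

definition divergence_weight :: "ereal \<Rightarrow> real" where
  "divergence_weight \<gamma> = 1 - real_of_ereal (inverse (1 + \<gamma>))"

lemma divergence_weight_infinity: "divergence_weight \<infinity> = 1"
  by (simp add: divergence_weight_def)

lemma divergence_weight_ereal:
  assumes "0 \<le> \<gamma>"
  shows "divergence_weight (ereal \<gamma>) = \<gamma> / (1 + \<gamma>)"
  using assms by (simp add: divergence_weight_def one_ereal_def field_simps)

lemma divergence_weight_in_unit:
  assumes "0 \<le> \<gamma>"
  shows "divergence_weight \<gamma> \<in> {0..1}"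
  using assms by (cases \<gamma>) (auto simp: divergence_weight_ereal divergence_weight_infinity)

lemma continuous_on_divergence_weight: "continuous_on {0..} divergence_weight"
proof -
  have add: "continuous_on {0..} (\<lambda>\<gamma>::ereal. 1 + \<gamma>)"
    unfolding continuous_on_def by (intro ballI tendsto_add_ereal_nonneg tendsto_intros) auto
  have pos: "0 \<le> 1 + \<gamma>" if "0 \<le> \<gamma>" for \<gamma> :: ereal
    using that by simp
  have "continuous_on {0..} (\<lambda>\<gamma>::ereal. inverse (1 + \<gamma>))"
    by (rule continuous_on_compose2[OF continuous_on_inverse_ereal add]) (use pos in auto)
  moreover have "inverse (1 + \<gamma>) \<in> UNIV - {\<infinity>, -\<infinity>}" if "0 \<le> \<gamma>" for \<gamma> :: ereal
    using that by (cases \<gamma>) (auto simp: one_ereal_def)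
  ultimately have "continuous_on {0..} (\<lambda>\<gamma>::ereal. real_of_ereal (inverse (1 + \<gamma>)))"
    by (intro continuous_on_compose2[OF continuous_on_real]) auto
  then show ?thesis
    unfolding divergence_weight_def by (intro continuous_intros)
qed

theorem theorem3p11:
  fixes C :: "real^'n^'n" and f :: "real \<Rightarrow> real"
  assumes "CARD('n) \<ge> 2"
    and "strictly_convex_on {0..1} f"
    and "continuous_on {0..1} f"
    and "C1_on {0<..1} f"
  shows "(\<forall>(X :: nat \<Rightarrow> real^'n) (Y :: nat \<Rightarrow> real^'n) x y (\<Gamma> :: nat \<Rightarrow> real) (\<gamma> :: ereal).
            (\<forall>n. (X n, Y n) \<in> prob_vectors \<times> prob_vectors) \<and>
            (x, y) \<in> prob_vectors \<times> prob_vectors \<and>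
            (\<lambda>n. (X n, Y n)) \<longlonglongrightarrow> (x, y) \<and>
            (\<forall>n. \<Gamma> n > 0) \<and> \<gamma> \<in> {0..\<infinity>} \<and> (\<lambda>n. ereal (\<Gamma> n)) \<longlonglongrightarrow> \<gamma> \<longrightarrow>
            (\<lambda>n. reg_coupling C f (\<Gamma> n) (X n) (Y n)) \<longlonglongrightarrow>
              (if \<gamma> = \<infinity> then outer x y
               else if \<gamma> = 0 then limit_coupling C f x y
               else reg_coupling C f (real_of_ereal \<gamma>) x y))
       \<and> continuous_on ({0<..} \<times> prob_vectors \<times> prob_vectors)
            (\<lambda>(\<gamma>, x, y). reg_cost C f \<gamma> x y)
       \<and> (\<exists>g :: ereal \<times> (real^'n) \<times> (real^'n) \<Rightarrow> real.
            continuous_on ({0..\<infinity>} \<times> prob_vectors \<times> prob_vectors) g \<and>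
            (\<forall>\<gamma> > 0. \<forall>x\<in>prob_vectors. \<forall>y\<in>prob_vectors.
               g (ereal \<gamma>, x, y) = reg_cost C f \<gamma> x y))"
proof -
  interpret bregman_generator f
    by unfold_locales (fact assms)+
  \<comment> \<open>The selected coupling as a function of \<open>\<gamma> \<in> [0,\<infinity>]\<close>; its three cases are the three limits, so
     that convergence and the continuous extension of the cost both follow from its continuity.\<close>
  define L where "L = (\<lambda>(\<gamma>, x, y). selection C (divergence_weight \<gamma>, x, y))"
  have L_cont: "continuous_on ({0..\<infinity>} \<times> prob_vectors \<times> prob_vectors) L"
    unfolding L_def case_prod_beta
    by (rule continuous_on_compose2[OF continuous_on_selection])
       (auto intro!: continuous_intros continuous_on_compose2[OF continuous_on_divergence_weight]
          simp: divergence_weight_in_unit[simplified])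
  have L_reg: "L (ereal \<gamma>, x, y) = reg_coupling C f \<gamma> x y"
    if "0 < \<gamma>" "x \<in> prob_vectors" "y \<in> prob_vectors" for \<gamma> x y
    using that by (simp add: L_def divergence_weight_ereal selection_eq_reg_coupling)
  have L_lim: "L (\<gamma>, x, y) = (if \<gamma> = \<infinity> then outer x y else if \<gamma> = 0 then limit_coupling C f x y
      else reg_coupling C f (real_of_ereal \<gamma>) x y)"
    if "0 \<le> \<gamma>" "x \<in> prob_vectors" "y \<in> prob_vectors" for \<gamma> x y
    using that L_reg selection_1[of x y C] selection_eq_limit_coupling[of x y C]
      divergence_weight_ereal[of 0]
    by (cases \<gamma>) (auto simp: L_def divergence_weight_infinity zero_ereal_def)
  have part1: "(\<lambda>n. reg_coupling C f (\<Gamma> n) (X n) (Y n)) \<longlonglongrightarrow> (if \<gamma> = \<infinity> then outer x y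
      else if \<gamma> = 0 then limit_coupling C f x y else reg_coupling C f (real_of_ereal \<gamma>) x y)"
    if XY: "\<forall>n. (X n, Y n) \<in> prob_vectors \<times> prob_vectors" "(x, y) \<in> prob_vectors \<times> prob_vectors"
      "(\<lambda>n. (X n, Y n)) \<longlonglongrightarrow> (x, y)"
      and \<Gamma>: "\<forall>n. \<Gamma> n > 0" "\<gamma> \<in> {0..\<infinity>}" "(\<lambda>n. ereal (\<Gamma> n)) \<longlonglongrightarrow> \<gamma>"
    for X Y :: "nat \<Rightarrow> real^'n" and x y and \<Gamma> :: "nat \<Rightarrow> real" and \<gamma> :: ereal
  proof -
    have "(\<lambda>n. L (ereal (\<Gamma> n), X n, Y n)) \<longlonglongrightarrow> L (\<gamma>, x, y)"
      by (rule continuous_on_tendsto_compose[OF L_cont])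
         (use XY \<Gamma> in \<open>auto intro!: tendsto_Pair simp: less_imp_le\<close>)
    moreover have "L (ereal (\<Gamma> n), X n, Y n) = reg_coupling C f (\<Gamma> n) (X n) (Y n)" for n
      using XY(1) \<Gamma>(1) by (auto intro: L_reg)
    ultimately show ?thesis using XY(2) \<Gamma>(2) L_lim[of \<gamma> x y] by simp
  qed
  define g where "g p = C \<bullet> L p" for p
  have g_cont: "continuous_on ({0..\<infinity>} \<times> prob_vectors \<times> prob_vectors) g"
    unfolding g_def by (intro continuous_intros L_cont)
  have g_reg: "g (ereal \<gamma>, x, y) = reg_cost C f \<gamma> x y"
    if "0 < \<gamma>" "x \<in> prob_vectors" "y \<in> prob_vectors" for \<gamma> x y
    using that by (simp add: g_def reg_cost_def L_reg)
  have "continuous_on ({0<..} \<times> prob_vectors \<times> prob_vectors) (\<lambda>p. g (ereal (fst p), snd p))"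
    by (rule continuous_on_compose2[OF g_cont]) (auto intro!: continuous_intros)
  then have part2: "continuous_on ({0<..} \<times> prob_vectors \<times> prob_vectors) (\<lambda>(\<gamma>, x, y). reg_cost C f \<gamma> x y)"
    by (rule continuous_on_eq) (auto simp: g_reg)
  show ?thesis
    using part1 part2 g_cont g_reg by blast
qed

end
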